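(* For every positive integer $n$, the set $\mathrm{CSP}(n)$ of $n\times n$ CSP-matrices forms a real convex rational polyhedral cone (in $\mathbb{R}^{n\times n}$).
   Context: Rows of $n\times n$ matrices are indexed by $i=0,\dots,n-1$ and columns by $j=1,\dots,n$. Let $\omega_n$ be a primitive $n$-th root of unity. A matrix $A=(a_{ij})\in\mathbb{R}_{\ge 0}^{n\times n}$ is a CSP-matrix if for each $1\le k\le n$, $$\sum_{\substack{0\le i<n\\1\le j\le n}}a_{ij}\,\omega_n^{ki}=\sum_{0\le i<n}\ \sum_{j\mid k}a_{ij}.$$ $\mathrm{CSP}(n)$ denotes the set of all $n\times n$ CSP-matrices. A convex rational polyhedral cone is the solution set of finitely many homogeneous linear inequalities with rational coefficients. *)

theory Defs
  imports Complex_Main "Jordan_Normal_Form.Matrix"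
begin

definition primitive_root_of_unity :: "nat \<Rightarrow> complex \<Rightarrow> bool" where
  "primitive_root_of_unity n \<omega> \<longleftrightarrow>
     n > 0 \<and> \<omega> ^ n = 1 \<and> (\<forall>m. 0 < m \<and> m < n \<longrightarrow> \<omega> ^ m \<noteq> 1)"

(* Rows are indexed by 0, ..., n - 1 but columns by 1, ..., n, whereas both indices of
   the matrix type start at 0; hence column j is stored at position j - 1. *)
definition entry :: "'a mat \<Rightarrow> nat \<Rightarrow> nat \<Rightarrow> 'a" where
  "entry A i j = A $$ (i, j - 1)"

definition CSP_matrix :: "nat \<Rightarrow> complex \<Rightarrow> real mat \<Rightarrow> bool" where
  "CSP_matrix n \<omega> A \<longleftrightarrow>
     A \<in> carrier_mat n n \<and>
     (\<forall>i\<in>{0..<n}. \<forall>j\<in>{1..n}. entry A i j \<ge> 0) \<and>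
     (\<forall>k\<in>{1..n}.
        (\<Sum>i = 0..<n. \<Sum>j = 1..n. complex_of_real (entry A i j) * \<omega> ^ (k * i)) =
        (\<Sum>i = 0..<n. \<Sum>j | j \<in> {1..n} \<and> j dvd k. complex_of_real (entry A i j)))"

definition CSP :: "nat \<Rightarrow> complex \<Rightarrow> real mat set" where
  "CSP n \<omega> = {A. CSP_matrix n \<omega> A}"

(* Each matrix in F is the rational coefficient vector of one inequality on the entries. *)
definition convex_rational_polyhedral_cone :: "nat \<Rightarrow> real mat set \<Rightarrow> bool" where
  "convex_rational_polyhedral_cone n C \<longleftrightarrow>
     (\<exists>F :: rat mat set. finite F \<and> F \<subseteq> carrier_mat n n \<and>
        C = {A \<in> carrier_mat n n.
               \<forall>c\<in>F. (\<Sum>i = 0..<n. \<Sum>j = 1..n. of_rat (entry c i j) * entry A i j) \<ge> 0})"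

end

theory Submission
  imports Defs "HOL-Computational_Algebra.Polynomial"
begin

text \<open>
  Write \<open>r i\<close> for the sum of row \<open>i\<close> and \<open>c j\<close> for the sum of column \<open>j\<close> of a CSP-matrix.
  The defining equations say that the discrete Fourier transform of \<open>r\<close> takes, at \<open>k\<close>, the value
  \<open>\<Sum>j | j dvd k. c j\<close>.  Their coefficients lie in the cyclotomic field, and the point is to
  replace them by rational ones.  Linear algebra alone does not do this, because for a column index
  \<open>j\<close> that does not divide \<open>n\<close> the condition \<open>j dvd k\<close> is not stable under multiplying \<open>k\<close>,
  modulo \<open>n\<close>, by a unit; the nonnegativity of the entries is essential.

  At \<open>k = n\<close> all powers of the root of unity are 1, so the equation equates the sum of all entries
  with the sum of those in columns \<open>j\<close> dividing \<open>n\<close>.  As the entries are nonnegative, the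
  other columns vanish (\<open>columns_off_divisors_vanish\<close>).

  For \<open>j\<close> dividing \<open>n\<close>, the function \<open>k \<mapsto> (if j dvd k then 1 else 0)\<close> is the Fourier transform
  of the uniform distribution on the subgroup of order \<open>j\<close> of the integers modulo \<open>n\<close>
  (\<open>sum_primitive_root_powers_subgroup\<close>), which has rational values.  The Fourier transform is
  injective (\<open>fourier_coefficients_unique\<close>), so once the other columns vanish the CSP equations hold if and only if
  \<open>r\<close> is the corresponding combination, with weights \<open>c j\<close>, of these distributions
  (\<open>CSP_matrix_iff_rational_equations\<close>).  These are rational linear equations, and an
  equation is a pair of opposite inequalities.
\<close>

section \<open>Powers of a primitive root of unity\<close>

lemma primitive_root_power_eq_1_iff:
  assumes "primitive_root_of_unity n \<omega>"
  shows "\<omega> ^ m = 1 \<longleftrightarrow> n dvd m"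
proof -
  have n: "n > 0" "\<omega> ^ n = 1" and least: "\<And>l. 0 < l \<Longrightarrow> l < n \<Longrightarrow> \<omega> ^ l \<noteq> 1"
    using assms by (auto simp: primitive_root_of_unity_def)
  have "\<omega> ^ m = \<omega> ^ (n * (m div n) + m mod n)" by simp
  also have "\<dots> = \<omega> ^ (m mod n)" by (simp only: power_add power_mult n power_one mult_1)
  finally have "\<omega> ^ m = 1 \<longleftrightarrow> \<omega> ^ (m mod n) = 1" by simp
  also have "\<dots> \<longleftrightarrow> m mod n = 0"
    using least[of "m mod n"] n(1) by (cases "m mod n = 0") auto
  finally show ?thesis by (simp add: dvd_eq_mod_eq_0)
qed

lemma inj_on_primitive_root_powers:
  assumes "primitive_root_of_unity n \<omega>"
  shows "inj_on (\<lambda>k. \<omega> ^ k) {1..n}"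
proof (rule linorder_inj_onI')
  fix k l assume kl: "k \<in> {1..n}" "l \<in> {1..n}" "k < l"
  have "\<omega> \<noteq> 0"
    using assms by (auto simp: primitive_root_of_unity_def zero_power)
  moreover have "\<not> n dvd l - k"
    using kl by (auto dest: dvd_imp_le)
  moreover have "\<omega> ^ l = \<omega> ^ k * \<omega> ^ (l - k)"
    using kl by (simp flip: power_add)
  ultimately show "\<omega> ^ k \<noteq> \<omega> ^ l"
    using primitive_root_power_eq_1_iff[OF assms] by simp
qed

section \<open>The discrete Fourier transform\<close>

text \<open>
  The difference of the two sequences is the coefficient sequence of a polynomial of degree less
  than \<open>n\<close> that has the \<open>n\<close> distinct powers of \<open>\<omega>\<close> as roots.
\<close>
lemma fourier_coefficients_unique:
  fixes g h :: "nat \<Rightarrow> complex"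
  assumes "primitive_root_of_unity n \<omega>"
    and eq: "\<And>k. k \<in> {1..n} \<Longrightarrow>
      (\<Sum>i = 0..<n. g i * \<omega> ^ (k * i)) = (\<Sum>i = 0..<n. h i * \<omega> ^ (k * i))"
    and "i < n"
  shows "g i = h i"
proof -
  define p where "p = (\<Sum>i = 0..<n. monom (g i - h i) i)"
  have coeff_p: "coeff p l = (if l < n then g l - h l else 0)" for l
    unfolding p_def by (simp add: coeff_sum)
  have "p = 0"
  proof (rule ccontr)
    assume "p \<noteq> 0"
    have "poly p (\<omega> ^ k) = 0" if "k \<in> {1..n}" for k
      using eq[OF that]
      by (simp add: p_def poly_sum poly_monom left_diff_distrib sum_subtractf flip: power_mult)
    then have "card ((\<lambda>k. \<omega> ^ k) ` {1..n}) \<le> card {z. poly p z = 0}"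
      by (intro card_mono poly_roots_finite \<open>p \<noteq> 0\<close>) auto
    also have "\<dots> \<le> degree p"
      using \<open>p \<noteq> 0\<close> by (rule card_poly_roots_bound)
    also have "\<dots> < n"
    proof (rule ccontr)
      assume "\<not> degree p < n"
      then have "coeff p (degree p) = 0" by (simp add: coeff_p)
      with \<open>p \<noteq> 0\<close> show False by simp
    qed
    finally show False
      using card_image[OF inj_on_primitive_root_powers[OF assms(1)]] by simp
  qed
  then show ?thesis using coeff_p[of i] \<open>i < n\<close> by simp
qed

text \<open>
  Orthogonality of characters on the subgroup of order \<open>j\<close> of the integers modulo \<open>n\<close>:  it consists
  of the multiples of \<open>n div j\<close>, which are the \<open>i\<close> with \<open>n dvd i * j\<close>, so the left-hand side is a
  geometric sum whose ratio is a \<open>j\<close>-th root of unity.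
\<close>
lemma sum_primitive_root_powers_subgroup:
  assumes prim: "primitive_root_of_unity n \<omega>" and j: "j dvd n"
  shows "(\<Sum>i | i < n \<and> n dvd i * j. \<omega> ^ (k * i)) = (if j dvd k then of_nat j else 0)"
proof -
  have "n > 0" using prim by (simp add: primitive_root_of_unity_def)
  obtain d where d: "n = d * j" using j by (metis dvd_def mult.commute)
  with \<open>n > 0\<close> have pos: "d > 0" "j > 0" by auto
  have multiples: "{i. i < n \<and> n dvd i * j} = (\<lambda>t. t * d) ` {..<j}"
    using pos by (auto simp: d image_iff elim!: dvdE)
  define z where "z = \<omega> ^ (k * d)"
  have z1: "z = 1 \<longleftrightarrow> j dvd k"
    using pos by (simp add: z_def primitive_root_power_eq_1_iff[OF prim] d mult.commute)
  have zj: "z ^ j = 1"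
    by (simp add: z_def primitive_root_power_eq_1_iff[OF prim] d flip: power_mult)
  have "(\<Sum>i | i < n \<and> n dvd i * j. \<omega> ^ (k * i)) = (\<Sum>t<j. z ^ t)"
    unfolding multiples using pos
    by (subst sum.reindex) (auto simp: inj_on_def z_def algebra_simps simp flip: power_mult)
  also have "\<dots> = (if j dvd k then of_nat j else 0)"
    using z1 zj by (auto simp: sum_gp_strict)
  finally show ?thesis .
qed

text \<open>
  The sequence transformed here spreads each weight \<open>c j\<close> uniformly over the subgroup of order
  \<open>j\<close>.  It thus solves the equations for the row sums when the column sums \<open>c\<close> are given.
\<close>
lemma fourier_sum_of_subgroup_averages:
  fixes c :: "nat \<Rightarrow> real"
  assumes prim: "primitive_root_of_unity n \<omega>"
  shows "(\<Sum>i = 0..<n.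
            complex_of_real (\<Sum>j | j dvd n \<and> n dvd i * j. c j / real j) * \<omega> ^ (k * i))
       = complex_of_real (\<Sum>j | j dvd n \<and> j dvd k. c j)"
proof -
  have n: "n > 0" using prim by (simp add: primitive_root_of_unity_def)
  then have fin: "finite {j. j dvd n}" by simp
  have "(\<Sum>i = 0..<n.
            complex_of_real (\<Sum>j | j dvd n \<and> n dvd i * j. c j / real j) * \<omega> ^ (k * i))
      = (\<Sum>i = 0..<n. \<Sum>j | j dvd n.
            if n dvd i * j then complex_of_real (c j / real j) * \<omega> ^ (k * i) else 0)"
    using fin by (simp add: sum_distrib_right sum.inter_filter[symmetric])
  also have "\<dots> = (\<Sum>j | j dvd n. complex_of_real (c j / real j) *
                    (\<Sum>i | i < n \<and> n dvd i * j. \<omega> ^ (k * i)))"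
    by (subst sum.swap) (simp add: sum_distrib_left sum.inter_filter[symmetric])
  also have "\<dots> = (\<Sum>j | j dvd n. if j dvd k then complex_of_real (c j) else 0)"
    using n by (intro sum.cong refl) (auto simp: sum_primitive_root_powers_subgroup[OF prim])
  also have "\<dots> = complex_of_real (\<Sum>j | j dvd n \<and> j dvd k. c j)"
    using fin by (simp add: sum.inter_filter[symmetric])
  finally show ?thesis .
qed

section \<open>CSP-matrices as solutions of rational equations\<close>

text \<open>
  The terms that the left-hand side of the equation has in addition to those of the right-hand side
  are nonnegative and add up to 0.
\<close>
lemma columns_off_divisors_vanish:
  fixes a :: "nat \<Rightarrow> nat \<Rightarrow> real"
  assumes nonneg: "\<And>i j. i \<in> {0..<n} \<Longrightarrow> j \<in> {1..n} \<Longrightarrow> a i j \<ge> 0"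
    and eq: "(\<Sum>i = 0..<n. \<Sum>j = 1..n. a i j) = (\<Sum>i = 0..<n. \<Sum>j | j \<in> {1..n} \<and> j dvd n. a i j)"
    and "i \<in> {0..<n}" "j \<in> {1..n}" "\<not> j dvd n"
  shows "a i j = 0"
proof -
  define B where "B = {j \<in> {1..n}. \<not> j dvd n}"
  have "(\<Sum>j = 1..n. a i j) = (\<Sum>j | j \<in> {1..n} \<and> j dvd n. a i j) + (\<Sum>j\<in>B. a i j)" for i
    unfolding B_def by (subst sum.union_disjoint[symmetric]) (auto intro!: sum.cong)
  with eq have "(\<Sum>i = 0..<n. \<Sum>j\<in>B. a i j) = 0"
    by (simp add: sum.distrib)
  then have "(\<Sum>j\<in>B. a i j) = 0"
    using \<open>i \<in> _\<close> by (subst (asm) sum_nonneg_eq_0_iff) (auto simp: B_def intro!: sum_nonneg nonneg)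
  then show ?thesis
    using assms(3-) by (subst (asm) sum_nonneg_eq_0_iff) (auto simp: B_def intro: nonneg)
qed

text \<open>
  Once the columns whose index does not divide \<open>n\<close> vanish, both sides of the CSP equation for \<open>k\<close> are values
  at \<open>k\<close> of Fourier transforms, namely of the two sides of the row equations below.
\<close>
lemma CSP_matrix_iff_rational_equations:
  assumes prim: "primitive_root_of_unity n \<omega>"
  shows "CSP_matrix n \<omega> A \<longleftrightarrow>
     A \<in> carrier_mat n n \<and>
     (\<forall>i\<in>{0..<n}. \<forall>j\<in>{1..n}. entry A i j \<ge> 0) \<and>
     (\<forall>i\<in>{0..<n}. \<forall>j\<in>{1..n}. \<not> j dvd n \<longrightarrow> entry A i j = 0) \<and>
     (\<forall>i\<in>{0..<n}. (\<Sum>j = 1..n. entry A i j) =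
        (\<Sum>j | j dvd n \<and> n dvd i * j. (\<Sum>i' = 0..<n. entry A i' j) / real j))"
    (is "_ \<longleftrightarrow> ?carrier \<and> ?nonneg \<and> ?supp \<and> ?rows")
proof -
  let ?a = "entry A"
  let ?r = "\<lambda>i. \<Sum>j = 1..n. ?a i j"
  let ?r' = "\<lambda>i. \<Sum>j | j dvd n \<and> n dvd i * j. (\<Sum>i' = 0..<n. ?a i' j) / real j"
  let ?fourier = "\<lambda>k. (\<Sum>i = 0..<n. \<Sum>j = 1..n. complex_of_real (?a i j) * \<omega> ^ (k * i)) =
        (\<Sum>i = 0..<n. \<Sum>j | j \<in> {1..n} \<and> j dvd k. complex_of_real (?a i j))"
  have n: "n > 0" and \<omega>n: "\<omega> ^ n = 1"
    using prim by (auto simp: primitive_root_of_unity_def)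
  have lhs: "(\<Sum>i = 0..<n. \<Sum>j = 1..n. complex_of_real (?a i j) * \<omega> ^ (k * i)) =
      (\<Sum>i = 0..<n. complex_of_real (?r i) * \<omega> ^ (k * i))" for k
    by (simp add: sum_distrib_right)
  have rhs: "(\<Sum>i = 0..<n. \<Sum>j | j \<in> {1..n} \<and> j dvd k. complex_of_real (?a i j)) =
      (\<Sum>i = 0..<n. complex_of_real (?r' i) * \<omega> ^ (k * i))" if ?supp for k
  proof -
    \<comment> \<open>After this step the inner index ranges over the divisors of \<open>gcd n k\<close>, so that the value
      depends on \<open>k\<close> modulo \<open>n\<close> only, as a Fourier transform must.\<close>
    have "(\<Sum>i = 0..<n. \<Sum>j | j \<in> {1..n} \<and> j dvd k. complex_of_real (?a i j)) =
        (\<Sum>i = 0..<n. \<Sum>j | j dvd n \<and> j dvd k. complex_of_real (?a i j))"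
    proof (rule sum.cong[OF refl], rule sum.mono_neutral_right)
      show "{j. j dvd n \<and> j dvd k} \<subseteq> {j. j \<in> {1..n} \<and> j dvd k}"
        using n by (auto dest: dvd_imp_le simp: Suc_le_eq intro: dvd_pos_nat)
      fix i assume "i \<in> {0..<n}"
      with that show "\<forall>j \<in> {j. j \<in> {1..n} \<and> j dvd k} - {j. j dvd n \<and> j dvd k}.
          complex_of_real (?a i j) = 0"
        by (metis (no_types, lifting) Diff_iff mem_Collect_eq of_real_0)
    qed simp
    also have "\<dots> = complex_of_real (\<Sum>j | j dvd n \<and> j dvd k. \<Sum>i = 0..<n. ?a i j)"
      by (subst sum.swap) simp
    also have "\<dots> = (\<Sum>i = 0..<n. complex_of_real (?r' i) * \<omega> ^ (k * i))"
      by (rule fourier_sum_of_subgroup_averages[OF prim, symmetric])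
    finally show ?thesis .
  qed
  have supp: ?supp if ?nonneg "?fourier n"
  proof -
    have "complex_of_real (\<Sum>i = 0..<n. \<Sum>j = 1..n. ?a i j) =
        complex_of_real (\<Sum>i = 0..<n. \<Sum>j | j \<in> {1..n} \<and> j dvd n. ?a i j)"
      using that(2) by (simp add: power_mult \<omega>n)
    then have "(\<Sum>i = 0..<n. \<Sum>j = 1..n. ?a i j) =
        (\<Sum>i = 0..<n. \<Sum>j | j \<in> {1..n} \<and> j dvd n. ?a i j)"
      by (simp only: of_real_eq_iff)
    with that(1) show ?thesis
      using columns_off_divisors_vanish[of n ?a] by blast
  qed
  have "(\<forall>k\<in>{1..n}. ?fourier k) \<longleftrightarrow> ?rows" if ?supp
  proof
    assume fourier: "\<forall>k\<in>{1..n}. ?fourier k"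
    show ?rows
    proof
      fix i assume "i \<in> {0..<n}"
      have "complex_of_real (?r i) = complex_of_real (?r' i)"
      proof (rule fourier_coefficients_unique[OF prim])
        fix k assume "k \<in> {1..n}"
        with fourier have "?fourier k" by blast
        then show "(\<Sum>i = 0..<n. complex_of_real (?r i) * \<omega> ^ (k * i)) =
            (\<Sum>i = 0..<n. complex_of_real (?r' i) * \<omega> ^ (k * i))"
          by (simp only: lhs rhs[OF that])
      qed (use \<open>i \<in> {0..<n}\<close> in simp)
      then show "?r i = ?r' i" by (simp only: of_real_eq_iff)
    qed
  next
    assume rows: ?rows
    have "(\<Sum>i = 0..<n. complex_of_real (?r i) * \<omega> ^ (k * i)) =
        (\<Sum>i = 0..<n. complex_of_real (?r' i) * \<omega> ^ (k * i))" for k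
    proof (rule sum.cong[OF refl])
      fix i assume "i \<in> {0..<n}"
      with rows have "?r i = ?r' i" by blast
      then show "complex_of_real (?r i) * \<omega> ^ (k * i) = complex_of_real (?r' i) * \<omega> ^ (k * i)"
        by (simp only:)
    qed
    then show "\<forall>k\<in>{1..n}. ?fourier k"
      unfolding lhs rhs[OF that] by blast
  qed
  moreover have "n \<in> {1..n}" using n by simp
  ultimately show ?thesis
    unfolding CSP_matrix_def using supp by blast
qed

section \<open>Rational linear forms on matrices\<close>

text \<open>
  The columns of \<open>f\<close> are numbered from 1, like those of \<open>entry\<close>, hence the shift.
\<close>
definition coefficient_matrix :: "nat \<Rightarrow> (nat \<Rightarrow> nat \<Rightarrow> rat) \<Rightarrow> rat mat" where
  "coefficient_matrix n f = mat n n (\<lambda>(i, j). f i (Suc j))"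

definition functional :: "nat \<Rightarrow> rat mat \<Rightarrow> real mat \<Rightarrow> real" where
  "functional n c A = (\<Sum>i = 0..<n. \<Sum>j = 1..n. of_rat (entry c i j) * entry A i j)"

lemma functional_coefficient_matrix:
  "functional n (coefficient_matrix n f) A = (\<Sum>i = 0..<n. \<Sum>j = 1..n. of_rat (f i j) * entry A i j)"
  unfolding functional_def coefficient_matrix_def
  by (intro sum.cong refl) (auto simp: entry_def)

definition entry_form :: "nat \<Rightarrow> nat \<Rightarrow> nat \<Rightarrow> nat \<Rightarrow> rat" where
  "entry_form i j = (\<lambda>i' j'. if i' = i \<and> j' = j then 1 else 0)"

text \<open>
  The coefficients of the difference between the two sides of the equation for row \<open>i\<close> in
  \<open>CSP_matrix_iff_rational_equations\<close>; the column sums make every entry \<open>(i', j)\<close> occur in it, not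
  only those of row \<open>i\<close>.
\<close>
definition row_form :: "nat \<Rightarrow> nat \<Rightarrow> nat \<Rightarrow> nat \<Rightarrow> rat" where
  "row_form n i = (\<lambda>i' j.
     (if i' = i then 1 else 0) - (if j dvd n \<and> n dvd i * j then 1 / of_nat j else 0))"

lemma functional_entry_form:
  assumes "i \<in> {0..<n}" "j \<in> {1..n}"
  shows "functional n (coefficient_matrix n (entry_form i j)) A = entry A i j"
proof -
  have "functional n (coefficient_matrix n (entry_form i j)) A =
      (\<Sum>i' = 0..<n. \<Sum>j' = 1..n. if j' = j then if i' = i then entry A i' j' else 0 else 0)"
    unfolding functional_coefficient_matrix
    by (intro sum.cong refl) (simp add: entry_form_def)
  then show ?thesis using assms by simp
qed

lemma functional_row_form:
  assumes "i \<in> {0..<n}"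
  shows "functional n (coefficient_matrix n (row_form n i)) A =
    (\<Sum>j = 1..n. entry A i j) -
    (\<Sum>j | j dvd n \<and> n dvd i * j. (\<Sum>i' = 0..<n. entry A i' j) / real j)"
proof -
  have n: "n > 0" using assms by auto
  have divs: "{j. j dvd n \<and> n dvd i * j} = {j \<in> {1..n}. j dvd n \<and> n dvd i * j}"
    using n by (auto dest: dvd_imp_le simp: Suc_le_eq intro: dvd_pos_nat)
  have "functional n (coefficient_matrix n (row_form n i)) A =
      (\<Sum>i' = 0..<n. if i' = i then \<Sum>j = 1..n. entry A i' j else 0) -
      (\<Sum>i' = 0..<n. \<Sum>j = 1..n. if j dvd n \<and> n dvd i * j then entry A i' j / real j else 0)"
    unfolding functional_coefficient_matrix row_form_def sum_subtractf[symmetric]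
    by (intro sum.cong refl)
      (auto simp: of_rat_diff of_rat_divide left_diff_distrib sum_subtractf intro!: sum.cong)
  also have "(\<Sum>i' = 0..<n. \<Sum>j = 1..n. if j dvd n \<and> n dvd i * j then entry A i' j / real j else 0)
      = (\<Sum>j | j dvd n \<and> n dvd i * j. (\<Sum>i' = 0..<n. entry A i' j) / real j)"
    unfolding divs sum_divide_distrib sum.inter_filter[OF finite_atLeastAtMost]
    by (subst sum.swap) (auto intro!: sum.cong)
  finally show ?thesis using assms by simp
qed

lemma functional_uminus_coefficient_matrix:
  "functional n (coefficient_matrix n (\<lambda>i j. - f i j)) A = - functional n (coefficient_matrix n f) A"
  by (simp add: functional_coefficient_matrix of_rat_minus sum_negf)

section \<open>The cone of CSP-matrices\<close>

theorem corollary4p4: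
  fixes n :: nat and \<omega> :: complex
  assumes "n > 0"
    and "primitive_root_of_unity n \<omega>"
  shows "convex_rational_polyhedral_cone n (CSP n \<omega>)"
proof -
  \<comment> \<open>The forms in \<open>G\<close> are to be nonnegative and those in \<open>H\<close> are to vanish; the latter therefore
    enter \<open>F\<close> with both signs.\<close>
  define E where "E = (\<lambda>(i, j). entry_form i j)"
  define G where "G = E ` ({0..<n} \<times> {1..n})"
  define H where "H = E ` ({0..<n} \<times> {j \<in> {1..n}. \<not> j dvd n}) \<union> row_form n ` {0..<n}"
  define F where "F = coefficient_matrix n ` (G \<union> H \<union> (\<lambda>f i j. - f i j) ` H)"
  have "finite F"
    by (simp add: F_def G_def H_def)
  moreover have "F \<subseteq> carrier_mat n n"
    by (auto simp: F_def coefficient_matrix_def)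
  moreover have "CSP n \<omega> = {A \<in> carrier_mat n n. \<forall>c\<in>F. functional n c A \<ge> 0}"
  proof -
    let ?L = "\<lambda>f. functional n (coefficient_matrix n f)"
    have "(\<forall>c\<in>F. functional n c A \<ge> 0) \<longleftrightarrow> (\<forall>f\<in>G. ?L f A \<ge> 0) \<and> (\<forall>f\<in>H. ?L f A = 0)" for A
      unfolding F_def by (auto simp: ball_Un functional_uminus_coefficient_matrix intro: antisym)
    then show ?thesis
      unfolding CSP_def CSP_matrix_iff_rational_equations[OF assms(2)]
      by (auto simp: G_def H_def E_def ball_Un functional_entry_form functional_row_form)
  qed
  ultimately show ?thesis
    unfolding convex_rational_polyhedral_cone_def functional_def by blast
qed

end
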